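(* For any integer $n\ge1$, let $T_n$ be the $n$th arrival time of a Poisson process with intensity $1$. Let $(X_n)_{n\ge1}$ be a sequence of i.i.d. symmetric random variables, which is assumed independent of $(T_n)_{n\ge1}$. Assume furthermore that $\mathbb{E}(|X_1|^{2p})<+\infty$ for some $p>0$. For $N\in\mathbb{N}$ and $\alpha\in(0,2)$ put $S_N^*(\alpha)=\sum_{n=1}^N T_n^{-1/\alpha}X_n$. 1. Then, almost surely, for all $b\in(0,\min(2,2p))$ and for all $a\in(0,b]$, the sequence of partial sums $(S_N^* )_{N\in\mathbb{N}}$ converges uniformly on $[a,b]$. 2. Moreover, almost surely, for all $b\in(0,\min(2,2p))$, for all $a\in(0,b)$ and for all $p'>0$ with $1/p'\in(0,1/b-1/\min(2p,2))$, $$\sup_{N\in\mathbb{N}}\ \sup_{\alpha\in[a,b]}N^{1/p'}\Big|\sum_{n=N+1}^{+\infty}T_n^{-1/\alpha}X_n\Big|<+\infty.$$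
   Context: A random variable $X$ is symmetric if $X$ and $-X$ have the same law. The infinite sum is the limit of the partial sums (which exists by assertion 1). *)

theory Defs
  imports "HOL-Probability.Probability"
begin

text \<open>
  A counting process with independent Poisson increments, indexed by times \<open>t \<ge> 0\<close>
  (values at negative times are irrelevant). The subtraction of natural numbers in the
  increments does not truncate, since the paths are nondecreasing.
\<close>

definition poisson_process :: "'a measure \<Rightarrow> real \<Rightarrow> (real \<Rightarrow> 'a \<Rightarrow> nat) \<Rightarrow> bool" where
  "poisson_process M rate P \<longleftrightarrow>
     prob_space M \<and>
     (\<forall>t\<ge>0. P t \<in> measurable M (count_space UNIV)) \<and>
     (\<forall>\<omega>\<in>space M. P 0 \<omega> = 0) \<and>
     (\<forall>\<omega>\<in>space M. mono_on {0..} (\<lambda>t. P t \<omega>)) \<and>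
     (\<forall>\<omega>\<in>space M. \<forall>t\<ge>0. continuous (at_right t) (\<lambda>s. P s \<omega>)) \<and>
     (\<forall>s t. 0 \<le> s \<and> s < t \<longrightarrow>
        distr M (count_space UNIV) (\<lambda>\<omega>. P t \<omega> - P s \<omega>)
          = measure_pmf (poisson_pmf (rate * (t - s)))) \<and>
     (\<forall>(k::nat) \<tau>. 0 \<le> \<tau> 0 \<and> (\<forall>i<k. \<tau> i < \<tau> (Suc i)) \<longrightarrow>
        prob_space.indep_vars M (\<lambda>_. count_space UNIV)
          (\<lambda>i \<omega>. P (\<tau> (Suc i)) \<omega> - P (\<tau> i) \<omega>) {..<k})"

text \<open>
  For a Poisson process of positive rate the set below is almost surely nonempty,
  so the value of \<open>Inf {}\<close> only matters on a null event.
\<close>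

definition arrival_time :: "(real \<Rightarrow> 'a \<Rightarrow> nat) \<Rightarrow> nat \<Rightarrow> 'a \<Rightarrow> real" where
  "arrival_time P n \<omega> = Inf {t. 0 \<le> t \<and> n \<le> P t \<omega>}"

definition symmetric_rv :: "'a measure \<Rightarrow> ('a \<Rightarrow> real) \<Rightarrow> bool" where
  "symmetric_rv M X \<longleftrightarrow>
     X \<in> borel_measurable M \<and> distr M borel X = distr M borel (\<lambda>\<omega>. - X \<omega>)"

definition S_star :: "(nat \<Rightarrow> 'a \<Rightarrow> real) \<Rightarrow> (nat \<Rightarrow> 'a \<Rightarrow> real) \<Rightarrow> 'a \<Rightarrow> nat \<Rightarrow> real \<Rightarrow> real" where
  "S_star T X \<omega> N \<alpha> = (\<Sum>n=1..N. T n \<omega> powr (- 1 / \<alpha>) * X n \<omega>)"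

text \<open>The tail \<open>\<Sum>\<^sub>n\<^sub>>\<^sub>N\<close>, reindexed by \<open>n = N + 1 + k\<close>; \<open>suminf\<close> is the limit of partial sums.\<close>

definition S_star_tail :: "(nat \<Rightarrow> 'a \<Rightarrow> real) \<Rightarrow> (nat \<Rightarrow> 'a \<Rightarrow> real) \<Rightarrow> 'a \<Rightarrow> nat \<Rightarrow> real \<Rightarrow> real" where
  "S_star_tail T X \<omega> N \<alpha> = (\<Sum>k. T (N + 1 + k) \<omega> powr (- 1 / \<alpha>) * X (N + 1 + k) \<omega>)"

end

theory Submission
  imports Defs "HOL-Real_Asymp.Real_Asymp"
begin

text \<open>
The two assertions follow from one pathwise estimate. Write \<open>q = min (2 * p) 2\<close> and
\<open>W n = X 1 + \<dots> + X n\<close>. Three facts hold almost surely.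

\<^item> For every \<open>\<gamma> > 1 / q\<close> the partial sums satisfy \<open>\<bar>W n\<bar> \<le> K * n powr \<gamma>\<close>, a weak form of
  the Marcinkiewicz--Zygmund law.  Truncating \<open>X n\<close> at the level \<open>n powr \<gamma>\<close> changes only finitely
  many terms, because the \<open>q\<close>-th moment is finite and \<open>\<gamma> * q > 1\<close>.  The truncated variables are
  centred by symmetry, hence orthogonal in \<open>L\<^sup>2\<close>, and the Rademacher--Menshov maximal
  inequality controls their partial sums along the powers of two.  It loses only a factor
  logarithmic in \<open>n\<close>, which the strict inequality \<open>\<gamma> > 1 / q\<close> absorbs
  (\<open>AE_identically_distributed_symmetric_sums_bounded\<close>).

\<^item> The arrival times increase.

\<^item> They satisfy \<open>c * n \<le> T n\<close> for some \<open>c > 0\<close>, by exponential moments of the Poisson law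
  (\<open>AE_arrival_times_linear_growth\<close>).

Now fix such a path. The weights \<open>T n powr (- 1 / \<alpha>)\<close> decrease in \<open>n\<close> and are at most a constant,
the same for all \<open>\<alpha> \<in> {a..b}\<close>, times \<open>n powr (- 1 / b)\<close>. Summation by parts replaces the oscillating
increments of \<open>W\<close> by the positive increments of its majorant \<open>K * n powr \<gamma>\<close>
(\<open>abel_comparison\<close>), so for \<open>\<gamma> < 1 / b\<close> each block of the series that starts after \<open>N\<close> is of order
\<open>N powr (\<gamma> - 1 / b)\<close>, uniformly in \<open>\<alpha>\<close> (\<open>S_star_increment_bound\<close>). This is a uniform Cauchy
criterion, and it is also the rate for the tails: \<open>\<gamma>\<close> may be taken
as close to \<open>1 / q\<close> as desired, so every exponent \<open>1 / p'\<close> below \<open>1 / b - 1 / q\<close> is reached.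
Countably many values of \<open>\<gamma>\<close> suffice, which gives a single null set for all parameters.
\<close>

section \<open>Almost sure convergence from summable expectations\<close>

text \<open>
The series has finite expectation, so it converges almost surely. The conclusion is used in two
ways: that the values are eventually below \<open>1\<close>, in the manner of the Borel--Cantelli lemma,
and that they are bounded, which turns moment bounds along the powers of two into pathwise ones.
\<close>

lemma AE_tendsto_zero_of_summable_integrals:
  fixes f :: "nat \<Rightarrow> 'a \<Rightarrow> real"
  assumes int: "\<And>n. integrable M (f n)" and nonneg: "\<And>n x. 0 \<le> f n x"
    and summ: "summable (\<lambda>n. \<integral>x. f n x \<partial>M)"
  shows "AE x in M. (\<lambda>n. f n x) \<longlonglongrightarrow> 0"
proof -
  have meas: "(\<lambda>x. ennreal (f n x)) \<in> borel_measurable M" for n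
    using borel_measurable_integrable[OF int[of n]] by measurable
  have "(\<integral>\<^sup>+x. (\<Sum>n. ennreal (f n x)) \<partial>M) = (\<Sum>n. \<integral>\<^sup>+x. ennreal (f n x) \<partial>M)"
    using meas by (rule nn_integral_suminf)
  also have "\<dots> = (\<Sum>n. ennreal (\<integral>x. f n x \<partial>M))"
    by (simp add: nn_integral_eq_integral int nonneg)
  also have "\<dots> = ennreal (\<Sum>n. \<integral>x. f n x \<partial>M)"
    by (rule suminf_ennreal_eq) (auto simp: nonneg summ summable_sums)
  finally have "(\<integral>\<^sup>+x. (\<Sum>n. ennreal (f n x)) \<partial>M) \<noteq> \<infinity>"
    by simp
  then have "AE x in M. (\<Sum>n. ennreal (f n x)) \<noteq> \<infinity>"
    using meas by (intro nn_integral_PInf_AE) auto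
  then show ?thesis
  proof eventually_elim
    case (elim x)
    then have "summable (\<lambda>n. f n x)"
      using nonneg by (intro summable_suminf_not_top) auto
    then show ?case by (rule summable_LIMSEQ_zero)
  qed
qed

section \<open>A maximal inequality for orthogonal sequences\<close>

text \<open>
The Rademacher--Menshov argument splits a block of length \<open>2 ^ Suc k\<close> into two halves. A partial
sum ends in the left half, or it is the full left half plus a partial sum of the right half.
Unfolding this dichotomy gives an explicit function that dominates the squares of all partial sums
of the block (\<open>square_partial_sum_le_dyadic_majorant\<close>). Taking the expectation of this function
avoids integrating a maximum. The weights \<open>k + 2\<close> and \<open>(k + 2) / (k + 1)\<close> are those for which
the factor \<open>(k + 1)\<^sup>2\<close> in \<open>integral_dyadic_majorant_le\<close> reproduces itself under the recursion.
\<close>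

primrec dyadic_majorant :: "(nat \<Rightarrow> real) \<Rightarrow> nat \<Rightarrow> nat \<Rightarrow> real" where
  "dyadic_majorant y 0 s = (y s)\<^sup>2"
| "dyadic_majorant y (Suc k) s =
     (real k + 2) * (\<Sum>i\<in>{s..<s + 2 ^ k}. y i)\<^sup>2
     + (real k + 2) / (real k + 1) * (dyadic_majorant y k s + dyadic_majorant y k (s + 2 ^ k))"

lemma dyadic_majorant_nonneg: "0 \<le> dyadic_majorant y k s"
  by (induction k arbitrary: s) auto

lemma square_sum_le_weighted:
  fixes a b t :: real
  assumes "t > 0"
  shows "(a + b)\<^sup>2 \<le> (t + 1) * a\<^sup>2 + (t + 1) / t * b\<^sup>2"
proof -
  have "(t + 1) * a\<^sup>2 + (t + 1) / t * b\<^sup>2 - (a + b)\<^sup>2 = (t * a - b)\<^sup>2 / t"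
    using assms by (simp add: field_simps power2_eq_square)
  also have "\<dots> \<ge> 0" using assms by simp
  finally show ?thesis by simp
qed

lemma square_partial_sum_le_dyadic_majorant:
  assumes "n \<le> 2 ^ k"
  shows "(\<Sum>i\<in>{s..<s + n}. y i)\<^sup>2 \<le> dyadic_majorant y k s"
  using assms
proof (induction k arbitrary: s n)
  case 0
  then have "n = 0 \<or> n = 1" by auto
  then show ?case by auto
next
  case (Suc k)
  let ?c = "(real k + 2) / (real k + 1)"
  have c: "?c \<ge> 1" by simp
  have nonneg: "0 \<le> dyadic_majorant y k s" for s by (rule dyadic_majorant_nonneg)
  show ?case
  proof (cases "n \<le> 2 ^ k")
    case True
    have "(\<Sum>i\<in>{s..<s + n}. y i)\<^sup>2 \<le> dyadic_majorant y k s"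
      using True by (rule Suc.IH)
    also have "\<dots> \<le> ?c * dyadic_majorant y k s"
      using mult_right_mono[OF c nonneg[of s]] by simp
    also have "\<dots> \<le> ?c * (dyadic_majorant y k s + dyadic_majorant y k (s + 2 ^ k))"
      using nonneg c by (intro mult_left_mono) auto
    also have "\<dots> \<le> dyadic_majorant y (Suc k) s" by simp
    finally show ?thesis .
  next
    case False
    define l where "l = n - 2 ^ k"
    have n: "n = 2 ^ k + l" and l: "l \<le> 2 ^ k" using False Suc.prems by (auto simp: l_def)
    let ?A = "\<Sum>i\<in>{s..<s + 2 ^ k}. y i" and ?B = "\<Sum>i\<in>{s + 2 ^ k..<s + 2 ^ k + l}. y i"
    have "(\<Sum>i\<in>{s..<s + n}. y i) = ?A + ?B"
      unfolding n using sum.atLeastLessThan_concat[of s "s + 2 ^ k" "s + 2 ^ k + l" y]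
      by (simp add: add.assoc)
    then have "(\<Sum>i\<in>{s..<s + n}. y i)\<^sup>2 = (?A + ?B)\<^sup>2" by simp
    also have "\<dots> \<le> (real k + 2) * ?A\<^sup>2 + ?c * ?B\<^sup>2"
      using square_sum_le_weighted[of "real k + 1" ?A ?B] by (simp add: add.commute)
    also have "\<dots> \<le> (real k + 2) * ?A\<^sup>2 + ?c * (dyadic_majorant y k s + dyadic_majorant y k (s + 2 ^ k))"
      using Suc.IH[OF l, of "s + 2 ^ k"] nonneg[of s] c
      by (intro add_left_mono mult_left_mono) auto
    finally show ?thesis by simp
  qed
qed

lemma integrable_mult_of_square_integrable:
  fixes f g :: "'a \<Rightarrow> real"
  assumes [measurable]: "f \<in> borel_measurable M" "g \<in> borel_measurable M"
    and "integrable M (\<lambda>x. (f x)\<^sup>2)" "integrable M (\<lambda>x. (g x)\<^sup>2)"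
  shows "integrable M (\<lambda>x. f x * g x)"
proof (rule Bochner_Integration.integrable_bound)
  show "integrable M (\<lambda>x. (f x)\<^sup>2 + (g x)\<^sup>2)" using assms by simp
  have "\<bar>a * b\<bar> \<le> a\<^sup>2 + b\<^sup>2" for a b :: real
  proof -
    have "0 \<le> \<bar>a\<bar> * \<bar>b\<bar>" by simp
    moreover have "2 * (\<bar>a\<bar> * \<bar>b\<bar>) \<le> a\<^sup>2 + b\<^sup>2"
      using sum_squares_bound[of "\<bar>a\<bar>" "\<bar>b\<bar>"] by (simp add: mult.assoc)
    ultimately show ?thesis unfolding abs_mult by linarith
  qed
  then show "AE x in M. norm (f x * g x) \<le> norm ((f x)\<^sup>2 + (g x)\<^sup>2)" by simp
qed simp

context
  fixes M :: "'a measure" and Y :: "nat \<Rightarrow> 'a \<Rightarrow> real"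
  assumes measurable_Y[measurable]: "\<And>i. Y i \<in> borel_measurable M"
    and square_integrable_Y: "\<And>i. integrable M (\<lambda>x. (Y i x)\<^sup>2)"
    and orthogonal_Y: "\<And>i j. i \<noteq> j \<Longrightarrow> (\<integral>x. Y i x * Y j x \<partial>M) = 0"
begin

text \<open>
Pythagoras: the mixed terms of the expanded square integrate to zero.
\<close>

lemma orthogonal_sum_square:
  assumes "finite I"
  shows "integrable M (\<lambda>x. (\<Sum>i\<in>I. Y i x)\<^sup>2)"
    and "(\<integral>x. (\<Sum>i\<in>I. Y i x)\<^sup>2 \<partial>M) = (\<Sum>i\<in>I. \<integral>x. (Y i x)\<^sup>2 \<partial>M)"
proof -
  have eq: "(\<Sum>i\<in>I. Y i x)\<^sup>2 = (\<Sum>i\<in>I. \<Sum>j\<in>I. Y i x * Y j x)" for x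
    by (simp add: power2_eq_square sum_product)
  have int: "integrable M (\<lambda>x. Y i x * Y j x)" for i j
    by (intro integrable_mult_of_square_integrable square_integrable_Y measurable_Y)
  show "integrable M (\<lambda>x. (\<Sum>i\<in>I. Y i x)\<^sup>2)"
    unfolding eq by (intro Bochner_Integration.integrable_sum int)
  have "(\<integral>x. (\<Sum>i\<in>I. Y i x)\<^sup>2 \<partial>M) = (\<Sum>i\<in>I. \<Sum>j\<in>I. \<integral>x. Y i x * Y j x \<partial>M)"
    unfolding eq by (simp add: int)
  also have "\<dots> = (\<Sum>i\<in>I. \<Sum>j\<in>I. if i = j then \<integral>x. (Y i x)\<^sup>2 \<partial>M else 0)"
    by (intro sum.cong) (auto simp: orthogonal_Y power2_eq_square)
  finally show "(\<integral>x. (\<Sum>i\<in>I. Y i x)\<^sup>2 \<partial>M) = (\<Sum>i\<in>I. \<integral>x. (Y i x)\<^sup>2 \<partial>M)"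
    using assms by simp
qed

text \<open>
The Rademacher--Menshov inequality. Both levels of the recursion see the same total variance, by
orthogonality, and \<open>(k + 2) + (k + 2) / (k + 1) * (k + 1)\<^sup>2 = (k + 2)\<^sup>2\<close>.
\<close>

lemma integral_dyadic_majorant_le:
  "integrable M (\<lambda>x. dyadic_majorant (\<lambda>i. Y i x) k s) \<and>
   (\<integral>x. dyadic_majorant (\<lambda>i. Y i x) k s \<partial>M)
     \<le> (real k + 1)\<^sup>2 * (\<Sum>i\<in>{s..<s + 2 ^ k}. \<integral>x. (Y i x)\<^sup>2 \<partial>M)"
proof (induction k arbitrary: s)
  case 0
  then show ?case by (simp add: square_integrable_Y)
next
  case (Suc k)
  let ?V = "\<lambda>s. \<Sum>i\<in>{s..<s + 2 ^ k}. \<integral>x. (Y i x)\<^sup>2 \<partial>M"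
  let ?c = "(real k + 2) / (real k + 1)"
  have V0: "?V s \<ge> 0" for s by (intro sum_nonneg) auto
  note int = Suc.IH[THEN conjunct1]
  have "(\<integral>x. dyadic_majorant (\<lambda>i. Y i x) (Suc k) s \<partial>M)
      = (real k + 2) * ?V s + ?c * ((\<integral>x. dyadic_majorant (\<lambda>i. Y i x) k s \<partial>M)
          + (\<integral>x. dyadic_majorant (\<lambda>i. Y i x) k (s + 2 ^ k) \<partial>M))"
    by (simp add: int orthogonal_sum_square)
  also have "\<dots> \<le> (real k + 2) * ?V s + ?c * ((real k + 1)\<^sup>2 * ?V s + (real k + 1)\<^sup>2 * ?V (s + 2 ^ k))"
    using Suc.IH[THEN conjunct2, of s] Suc.IH[THEN conjunct2, of "s + 2 ^ k"]
    by (intro add_left_mono mult_left_mono add_mono) auto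
  also have "\<dots> \<le> (real k + 2) * (?V s + ?V (s + 2 ^ k)) + ?c * ((real k + 1)\<^sup>2 * (?V s + ?V (s + 2 ^ k)))"
    using V0[of s] V0[of "s + 2 ^ k"] by (intro add_mono mult_left_mono) (auto simp: algebra_simps)
  also have "\<dots> = (real k + 2)\<^sup>2 * (?V s + ?V (s + 2 ^ k))"
    by (simp add: power2_eq_square field_simps)
  also have "?V s + ?V (s + 2 ^ k) = (\<Sum>i\<in>{s..<s + 2 ^ Suc k}. \<integral>x. (Y i x)\<^sup>2 \<partial>M)"
    using sum.atLeastLessThan_concat[of s "s + 2 ^ k" "s + 2 ^ k + 2 ^ k"]
    by (simp add: mult_2 add.assoc)
  finally show ?case
    by (simp add: int orthogonal_sum_square add.commute)
qed

end

lemma summable_square_times_exp_decay: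
  fixes c :: real
  assumes "c > 0"
  shows "summable (\<lambda>k. (real k + 1)\<^sup>2 * exp (- c * real k))"
proof (rule summable_comparison_test_bigo)
  show "summable (\<lambda>k. norm (exp (- c / 2) ^ k))"
    using assms by (simp add: summable_geometric)
  show "(\<lambda>k. (real k + 1)\<^sup>2 * exp (- c * real k)) \<in> O(\<lambda>k. exp (- c / 2) ^ k)"
    unfolding exp_of_nat_mult[symmetric] using assms by real_asymp
qed

text \<open>
By the maximal inequality, the normalised majorant of the block of length \<open>2 ^ k\<close> has expectation
of order \<open>(k + 1)\<^sup>2 * 2 powr (- \<delta> * k)\<close>. This is summable, so almost surely the
normalised majorants are bounded in \<open>k\<close>, and they dominate all partial sums up to the next power
of two.
\<close>

lemma AE_orthogonal_partial_sums_bounded: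
  fixes M :: "'a measure" and Y :: "nat \<Rightarrow> 'a \<Rightarrow> real" and \<gamma> \<delta> A :: real
  assumes meas: "\<And>i. Y i \<in> borel_measurable M"
    and sq: "\<And>i. integrable M (\<lambda>x. (Y i x)\<^sup>2)"
    and orth: "\<And>i j. i \<noteq> j \<Longrightarrow> (\<integral>x. Y i x * Y j x \<partial>M) = 0"
    and pos: "0 \<le> \<gamma>" "0 < \<delta>"
    and var: "\<And>n. n \<ge> 1 \<Longrightarrow> (\<Sum>i<n. \<integral>x. (Y i x)\<^sup>2 \<partial>M) \<le> A * real n powr (2 * \<gamma> - \<delta>)"
  shows "AE x in M. \<exists>K. \<forall>n. \<bar>\<Sum>i<n. Y i x\<bar> \<le> K * real n powr \<gamma>"
proof -
  define f where "f = (\<lambda>k x. dyadic_majorant (\<lambda>i. Y i x) k 0 / (2 ^ k) powr (2 * \<gamma>))"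
  note G = integral_dyadic_majorant_le[of Y M, OF meas sq orth]
  have int: "integrable M (f k)" for k
    unfolding f_def by (intro integrable_divide_zero) (simp add: G[THEN conjunct1])
  have f0: "0 \<le> f k x" for k x
    by (auto simp: f_def intro!: divide_nonneg_nonneg dyadic_majorant_nonneg)
  have bound: "(\<integral>x. f k x \<partial>M) \<le> A * ((real k + 1)\<^sup>2 * exp (- (\<delta> * ln 2) * real k))" for k
  proof -
    have e: "(2 ^ k :: real) powr (2 * \<gamma> - \<delta>) = exp (- (\<delta> * ln 2) * real k) * (2 ^ k) powr (2 * \<gamma>)"
      by (simp add: powr_def ln_realpow exp_add[symmetric] algebra_simps)
    have "(\<integral>x. f k x \<partial>M) = (\<integral>x. dyadic_majorant (\<lambda>i. Y i x) k 0 \<partial>M) / (2 ^ k) powr (2 * \<gamma>)"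
      by (simp add: f_def)
    also have "\<dots> \<le> ((real k + 1)\<^sup>2 * (\<Sum>i<2 ^ k. \<integral>x. (Y i x)\<^sup>2 \<partial>M)) / (2 ^ k) powr (2 * \<gamma>)"
      using G[THEN conjunct2, of k 0] by (intro divide_right_mono) (auto simp: atLeast0LessThan)
    also have "\<dots> \<le> ((real k + 1)\<^sup>2 * (A * real (2 ^ k) powr (2 * \<gamma> - \<delta>))) / (2 ^ k) powr (2 * \<gamma>)"
      by (intro divide_right_mono mult_left_mono var) auto
    also have "\<dots> = A * ((real k + 1)\<^sup>2 * exp (- (\<delta> * ln 2) * real k))"
      by (simp add: e)
    finally show ?thesis .
  qed
  have "summable (\<lambda>k. A * ((real k + 1)\<^sup>2 * exp (- (\<delta> * ln 2) * real k)))"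
    using pos by (intro summable_mult summable_square_times_exp_decay) simp
  then have "summable (\<lambda>k. \<integral>x. f k x \<partial>M)"
    by (rule summable_comparison_test'[where N = 0])
       (use bound f0 in \<open>simp add: Bochner_Integration.integral_nonneg\<close>)
  then have "AE x in M. (\<lambda>k. f k x) \<longlonglongrightarrow> 0"
    by (intro AE_tendsto_zero_of_summable_integrals int f0)
  then show ?thesis
  proof eventually_elim
    case (elim x)
    then have "Bseq (\<lambda>k. f k x)" by (intro convergent_imp_Bseq) (auto simp: convergent_def)
    then obtain B where B: "B > 0" "\<And>k. f k x \<le> B"
      unfolding Bseq_def by (auto simp: abs_le_iff)
    have "\<bar>\<Sum>i<n. Y i x\<bar> \<le> sqrt B * 2 powr \<gamma> * real n powr \<gamma>" for n
    proof (cases "n = 0")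
      case False
      then obtain k where k: "2 ^ k \<le> n" "n < 2 ^ (k + 1)"
        using ex_power_ivl1[of 2 n] by auto
      have dbl: "z powr (2 * \<gamma>) = (z powr \<gamma>)\<^sup>2" for z :: real
        by (simp only: mult_2 powr_add power2_eq_square)
      \<comment> \<open>The block of length \<open>2 ^ (k + 1)\<close> contains \<open>n\<close> and is at most twice as long.\<close>
      have "(\<Sum>i<n. Y i x)\<^sup>2 \<le> dyadic_majorant (\<lambda>i. Y i x) (k + 1) 0"
        using square_partial_sum_le_dyadic_majorant[of n "k + 1" "\<lambda>i. Y i x" 0] k
        by (simp add: atLeast0LessThan)
      also have "\<dots> = f (k + 1) x * (2 ^ (k + 1)) powr (2 * \<gamma>)" by (simp add: f_def)
      also have "\<dots> \<le> B * real (2 * n) powr (2 * \<gamma>)"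
      proof (intro mult_mono B powr_mono2)
        have "real (2 ^ (k + 1)) \<le> real (2 * n)" using k by (intro of_nat_mono) simp
        then show "(2::real) ^ (k + 1) \<le> real (2 * n)" by simp
      qed (use pos B in auto)
      also have "\<dots> = (sqrt B * (2 powr \<gamma> * real n powr \<gamma>))\<^sup>2"
        using B by (simp add: dbl powr_mult power_mult_distrib)
      finally have "\<bar>\<Sum>i<n. Y i x\<bar> \<le> \<bar>sqrt B * (2 powr \<gamma> * real n powr \<gamma>)\<bar>"
        by (simp only: abs_le_square_iff)
      then show ?thesis using B by (simp add: mult.assoc abs_mult)
    qed auto
    then show ?case by blast
  qed
qed

section \<open>Growth of partial sums of symmetric variables\<close>

lemma integral_eq_of_same_distribution:
  fixes h :: "real \<Rightarrow> real"
  assumes "distr M borel X = distr M borel Y"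
    and [measurable]: "X \<in> borel_measurable M" "Y \<in> borel_measurable M" "h \<in> borel_measurable borel"
  shows "(\<integral>x. h (X x) \<partial>M) = (\<integral>x. h (Y x) \<partial>M)"
    and "integrable M (\<lambda>x. h (X x)) \<longleftrightarrow> integrable M (\<lambda>x. h (Y x))"
proof -
  have "(\<integral>x. h (Z x) \<partial>M) = (\<integral>x. h x \<partial>distr M borel Z)"
    if "Z \<in> borel_measurable M" for Z using that by (simp add: integral_distr)
  then show "(\<integral>x. h (X x) \<partial>M) = (\<integral>x. h (Y x) \<partial>M)" using assms by simp
  have "integrable M (\<lambda>x. h (Z x)) \<longleftrightarrow> integrable (distr M borel Z) h"
    if "Z \<in> borel_measurable M" for Z using that by (simp add: integrable_distr_eq)
  then show "integrable M (\<lambda>x. h (X x)) \<longleftrightarrow> integrable M (\<lambda>x. h (Y x))" using assms by simp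
qed

lemma integral_odd_of_symmetric:
  fixes h :: "real \<Rightarrow> real"
  assumes X: "symmetric_rv M X" and h: "h \<in> borel_measurable borel" "\<And>x. h (- x) = - h x"
  shows "(\<integral>x. h (X x) \<partial>M) = 0"
proof -
  have [measurable]: "X \<in> borel_measurable M" using X by (simp add: symmetric_rv_def)
  have "(\<integral>x. h (X x) \<partial>M) = (\<integral>x. h (- X x) \<partial>M)"
    using X h(1) by (intro integral_eq_of_same_distribution) (auto simp: symmetric_rv_def)
  then show ?thesis by (simp add: h(2))
qed

text \<open>
Trades a bounded value for powers of the truncation level: this is what makes a \<open>q\<close>-th moment with
\<open>q \<le> 2\<close> control the variances of the truncated variables.
\<close>

lemma square_truncation_le:
  fixes x R q :: real
  assumes "\<bar>x\<bar> \<le> R" "q \<le> 2"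
  shows "x\<^sup>2 \<le> R powr (2 - q) * \<bar>x\<bar> powr q"
proof (cases "x = 0")
  case False
  have "x\<^sup>2 = \<bar>x\<bar> powr (2 - q) * \<bar>x\<bar> powr q"
    using False by (simp add: powr_add[symmetric])
  also have "\<dots> \<le> R powr (2 - q) * \<bar>x\<bar> powr q"
    using assms by (intro mult_right_mono powr_mono2) auto
  finally show ?thesis .
qed simp

text \<open>
Truncate \<open>X i\<close> at \<open>R i = (i + 1) powr \<gamma>\<close>. The truncation is an odd function of \<open>X i\<close>, so symmetry
keeps it centred and independence makes the truncated variables orthogonal. Their variances are at
most \<open>R i powr (2 - q)\<close> times the \<open>q\<close>-th moment, so the first \<open>n\<close> add up to order
\<open>n powr (1 + \<gamma> * (2 - q)) = n powr (2 * \<gamma> - \<delta>)\<close> with \<open>\<delta> = \<gamma> * q - 1 > 0\<close>, as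
\<open>AE_orthogonal_partial_sums_bounded\<close> requires. For the same reason \<open>\<gamma> * q > 1\<close>, the truncation
is almost surely inactive for all large \<open>i\<close>.
\<close>

lemma AE_identically_distributed_symmetric_sums_bounded:
  fixes X :: "nat \<Rightarrow> 'a \<Rightarrow> real" and q \<gamma> :: real
  assumes "prob_space M" and indep: "\<And>i j. i \<noteq> j \<Longrightarrow> prob_space.indep_var M borel (X i) borel (X j)"
    and ident: "\<And>n. distr M borel (X n) = distr M borel (X 0)"
    and symm: "\<And>n. symmetric_rv M (X n)"
    and q: "0 < q" "q \<le> 2" and moment: "integrable M (\<lambda>\<omega>. \<bar>X 0 \<omega>\<bar> powr q)"
    and \<gamma>: "1 / q < \<gamma>"
  shows "AE \<omega> in M. \<exists>K. \<forall>n. \<bar>\<Sum>i<n. X i \<omega>\<bar> \<le> K * real n powr \<gamma>"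
proof -
  interpret prob_space M by fact
  have \<gamma>q: "1 < \<gamma> * q" and \<gamma>0: "0 < \<gamma>" using q \<gamma> less_trans[of 0 "1 / q" \<gamma>] by (auto simp: field_simps)
  have [measurable]: "X n \<in> borel_measurable M" for n using symm by (simp add: symmetric_rv_def)
  define R where "R = (\<lambda>i. real (Suc i) powr \<gamma>)"
  define h :: "nat \<Rightarrow> real \<Rightarrow> real" where "h = (\<lambda>i x. if \<bar>x\<bar> \<le> R i then x else 0)"
  define Y where "Y = (\<lambda>i \<omega>. h i (X i \<omega>))"
  define A where "A = (\<integral>\<omega>. \<bar>X 0 \<omega>\<bar> powr q \<partial>M)"
  have A0: "A \<ge> 0" by (simp add: A_def)
  have h_meas[measurable]: "h i \<in> borel_measurable borel" for i
    unfolding h_def by measurable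
  have Y_meas[measurable]: "Y i \<in> borel_measurable M" for i unfolding Y_def by measurable
  have absY: "\<bar>Y i \<omega>\<bar> \<le> R i" for i \<omega> by (auto simp: Y_def h_def R_def)
  have Y_int: "integrable M (Y i)" for i
    using absY by (intro integrable_const_bound[where B = "R i"]) auto
  have Y_sq: "integrable M (\<lambda>\<omega>. (Y i \<omega>)\<^sup>2)" for i
    using absY power_mono[OF absY, of i _ 2]
    by (intro integrable_const_bound[where B = "(R i)\<^sup>2"]) auto
  have mom_int: "integrable M (\<lambda>\<omega>. \<bar>X i \<omega>\<bar> powr q)" and mom: "(\<integral>\<omega>. \<bar>X i \<omega>\<bar> powr q \<partial>M) = A" for i
    using integral_eq_of_same_distribution[OF ident, of i "\<lambda>x. \<bar>x\<bar> powr q"] moment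
    by (auto simp: A_def)
  have orth: "(\<integral>\<omega>. Y i \<omega> * Y j \<omega> \<partial>M) = 0" if "i \<noteq> j" for i j
  proof -
    have "indep_var borel (Y i) borel (Y j)"
      using indep_var_compose[OF indep[OF that] h_meas h_meas, of i j] by (simp add: Y_def comp_def)
    then have "(\<integral>\<omega>. Y i \<omega> * Y j \<omega> \<partial>M) = (\<integral>\<omega>. Y i \<omega> \<partial>M) * (\<integral>\<omega>. Y j \<omega> \<partial>M)"
      using Y_int by (intro indep_var_lebesgue_integral) auto
    moreover have "(\<integral>\<omega>. Y i \<omega> \<partial>M) = 0"
      unfolding Y_def by (rule integral_odd_of_symmetric[OF symm h_meas]) (simp add: h_def)
    ultimately show ?thesis by simp
  qed
  have Y_var: "(\<integral>\<omega>. (Y i \<omega>)\<^sup>2 \<partial>M) \<le> R i powr (2 - q) * A" for i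
  proof -
    have "(\<integral>\<omega>. (Y i \<omega>)\<^sup>2 \<partial>M) \<le> (\<integral>\<omega>. R i powr (2 - q) * \<bar>X i \<omega>\<bar> powr q \<partial>M)"
      using q by (intro integral_mono Y_sq integrable_mult_right mom_int)
        (auto simp: Y_def h_def square_truncation_le)
    then show ?thesis by (simp add: mom)
  qed
  have "AE \<omega> in M. \<exists>K. \<forall>n. \<bar>\<Sum>i<n. Y i \<omega>\<bar> \<le> K * real n powr \<gamma>"
  proof (rule AE_orthogonal_partial_sums_bounded[OF Y_meas Y_sq orth])
    show "0 \<le> \<gamma>" "0 < \<gamma> * q - 1" using \<gamma>0 \<gamma>q by auto
    fix n :: nat assume n: "n \<ge> 1"
    have "(\<Sum>i<n. \<integral>\<omega>. (Y i \<omega>)\<^sup>2 \<partial>M) \<le> (\<Sum>i<n. (real n powr \<gamma>) powr (2 - q) * A)"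
    proof (rule sum_mono)
      fix i assume "i \<in> {..<n}"
      then have "R i \<le> real n powr \<gamma>" unfolding R_def using \<gamma>0 by (intro powr_mono2) auto
      then have "R i powr (2 - q) * A \<le> (real n powr \<gamma>) powr (2 - q) * A"
        using q A0 by (intro mult_right_mono powr_mono2) (auto simp: R_def)
      then show "(\<integral>\<omega>. (Y i \<omega>)\<^sup>2 \<partial>M) \<le> (real n powr \<gamma>) powr (2 - q) * A"
        using Y_var[of i] by linarith
    qed
    also have "\<dots> = A * (real n powr 1 * real n powr (\<gamma> * (2 - q)))"
      using n by (simp add: powr_powr)
    also have "\<dots> = A * real n powr (2 * \<gamma> - (\<gamma> * q - 1))"
      unfolding powr_add[symmetric] by (simp add: algebra_simps)
    finally show "(\<Sum>i<n. \<integral>\<omega>. (Y i \<omega>)\<^sup>2 \<partial>M) \<le> A * real n powr (2 * \<gamma> - (\<gamma> * q - 1))" .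
  qed
  moreover have "AE \<omega> in M. (\<lambda>i. \<bar>X i \<omega>\<bar> powr q / R i powr q) \<longlonglongrightarrow> 0"
  proof (rule AE_tendsto_zero_of_summable_integrals)
    have "summable (\<lambda>i. real i powr (- (\<gamma> * q)))"
      using \<gamma>q by (simp add: summable_real_powr_iff)
    then have "summable (\<lambda>i. A * real (Suc i) powr (- (\<gamma> * q)))"
      by (intro summable_mult) (subst summable_Suc_iff)
    also have "(\<lambda>i. A * real (Suc i) powr (- (\<gamma> * q))) = (\<lambda>i. \<integral>\<omega>. \<bar>X i \<omega>\<bar> powr q / R i powr q \<partial>M)"
      by (simp add: mom R_def powr_powr powr_minus divide_inverse)
    finally show "summable (\<lambda>i. \<integral>\<omega>. \<bar>X i \<omega>\<bar> powr q / R i powr q \<partial>M)" .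
  qed (auto simp: mom_int)
  ultimately show ?thesis
  proof eventually_elim
    case (elim \<omega>)
    then obtain K where K: "\<And>n. \<bar>\<Sum>i<n. Y i \<omega>\<bar> \<le> K * real n powr \<gamma>" by blast
    have "\<forall>\<^sub>F i in sequentially. \<bar>X i \<omega>\<bar> powr q / R i powr q < 1"
      using elim(2) by (rule order_tendstoD) simp
    then have "\<forall>\<^sub>F i in sequentially. Y i \<omega> = X i \<omega>"
    proof eventually_elim
      case (elim i)
      then have "\<bar>X i \<omega>\<bar> powr q < R i powr q"
        by (subst (asm) pos_divide_less_eq) (auto simp: R_def)
      then have "\<bar>X i \<omega>\<bar> < R i"
        using q powr_mono2[of q "R i" "\<bar>X i \<omega>\<bar>"] by (auto simp: R_def not_less[symmetric])
      then show ?case by (simp add: Y_def h_def)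
    qed
    then obtain m where m: "\<And>i. i \<ge> m \<Longrightarrow> Y i \<omega> = X i \<omega>"
      unfolding eventually_sequentially by blast
    \<comment> \<open>The total effect of the finitely many active truncations.\<close>
    define B where "B = (\<Sum>i<m. \<bar>X i \<omega> - Y i \<omega>\<bar>)"
    have "\<bar>\<Sum>i<n. X i \<omega>\<bar> \<le> (K + B) * real n powr \<gamma>" for n
    proof (cases "n = 0")
      case False
      have "\<bar>\<Sum>i<n. X i \<omega> - Y i \<omega>\<bar> \<le> (\<Sum>i<n. \<bar>X i \<omega> - Y i \<omega>\<bar>)" by (rule sum_abs)
      also have "\<dots> = (\<Sum>i\<in>{..<n} \<inter> {..<m}. \<bar>X i \<omega> - Y i \<omega>\<bar>)"
        using m by (intro sum.mono_neutral_right) (auto simp: not_less[symmetric])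
      also have "\<dots> \<le> B" unfolding B_def by (intro sum_mono2) auto
      also have "B \<le> B * real n powr \<gamma>"
        using False \<gamma>0 mult_left_mono[of 1 "real n powr \<gamma>" B]
        by (simp add: B_def sum_nonneg ge_one_powr_ge_zero)
      finally have "\<bar>(\<Sum>i<n. X i \<omega>) - (\<Sum>i<n. Y i \<omega>)\<bar> \<le> B * real n powr \<gamma>"
        by (simp add: sum_subtractf)
      then show ?thesis using K[of n] by (simp add: algebra_simps)
    qed simp
    then show ?case by blast
  qed
qed

section \<open>Linear growth of Poisson arrival times\<close>

lemma poisson_generating_function:
  fixes r z :: real
  assumes "r > 0" "z \<ge> 0"
  shows "integrable (measure_pmf (poisson_pmf r)) (\<lambda>k. z ^ k)"
    and "(\<integral>k. z ^ k \<partial>measure_pmf (poisson_pmf r)) = exp (r * (z - 1))"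
proof -
  have "(\<lambda>k. (r * z) ^ k /\<^sub>R fact k) sums exp (r * z)" by (rule exp_converges)
  from sums_mult[OF this, of "exp (- r)"]
  have sums: "(\<lambda>k. r ^ k / fact k * exp (- r) * z ^ k) sums exp (r * (z - 1))"
    by (simp add: field_simps power_mult_distrib exp_diff exp_minus scaleR_conv_of_real)
  have "(\<integral>\<^sup>+k. ennreal (z ^ k) \<partial>measure_pmf (poisson_pmf r))
      = (\<integral>\<^sup>+k. ennreal (pmf (poisson_pmf r) k) * ennreal (z ^ k) \<partial>count_space UNIV)"
    by (rule nn_integral_measure_pmf)
  also have "\<dots> = (\<Sum>k. ennreal (r ^ k / fact k * exp (- r) * z ^ k))"
    using assms by (simp add: nn_integral_count_space_nat ennreal_mult'[symmetric])
  also have "\<dots> = ennreal (exp (r * (z - 1)))"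
    using assms by (intro suminf_ennreal_eq sums) auto
  finally have "integrable (measure_pmf (poisson_pmf r)) (\<lambda>k. z ^ k) \<and>
      (\<integral>k. z ^ k \<partial>measure_pmf (poisson_pmf r)) = exp (r * (z - 1))"
    using assms by (subst (asm) nn_integral_eq_integrable) auto
  then show "integrable (measure_pmf (poisson_pmf r)) (\<lambda>k. z ^ k)"
    and "(\<integral>k. z ^ k \<partial>measure_pmf (poisson_pmf r)) = exp (r * (z - 1))" by auto
qed

lemma poisson_process_generating_function:
  assumes P: "poisson_process M rate P" and "rate > 0" "t > 0" "z \<ge> (0::real)"
  shows "integrable M (\<lambda>\<omega>. z ^ P t \<omega>)"
    and "(\<integral>\<omega>. z ^ P t \<omega> \<partial>M) = exp (rate * t * (z - 1))"
proof -
  have [measurable]: "P t \<in> measurable M (count_space UNIV)"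
    using P \<open>t > 0\<close> unfolding poisson_process_def by auto
  have "distr M (count_space UNIV) (\<lambda>\<omega>. P t \<omega> - P 0 \<omega>) = measure_pmf (poisson_pmf (rate * (t - 0)))"
    using P \<open>t > 0\<close> unfolding poisson_process_def by blast
  moreover have "distr M (count_space UNIV) (\<lambda>\<omega>. P t \<omega> - P 0 \<omega>) = distr M (count_space UNIV) (P t)"
    using P unfolding poisson_process_def by (intro distr_cong) auto
  ultimately have d: "distr M (count_space UNIV) (P t) = measure_pmf (poisson_pmf (rate * t))"
    by simp
  have r: "rate * t > 0" using assms by simp
  show "integrable M (\<lambda>\<omega>. z ^ P t \<omega>)"
    using poisson_generating_function(1)[OF r \<open>z \<ge> 0\<close>]
    unfolding d[symmetric] by (subst (asm) integrable_distr_eq) auto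
  show "(\<integral>\<omega>. z ^ P t \<omega> \<partial>M) = exp (rate * t * (z - 1))"
    using poisson_generating_function(2)[OF r \<open>z \<ge> 0\<close>]
    unfolding d[symmetric] by (subst (asm) integral_distr) auto
qed

text \<open>
Both claims are Chernoff bounds. Since \<open>2 ^ P (n / 2)\<close> has expectation \<open>exp (n / 2)\<close> and
\<open>exp (1 / 2) < 2\<close>, the quotients \<open>2 ^ P (n / 2) / 2 ^ n\<close> have summable expectations and tend to
zero; and \<open>(1 / 2) ^ P n\<close> has expectation \<open>exp (- n / 2)\<close>, so it tends to zero and \<open>P\<close> is unbounded.
\<close>

lemma AE_poisson_process_between:
  assumes P: "poisson_process M 1 P"
  shows "AE \<omega> in M. (\<forall>n. \<exists>t\<ge>0. n \<le> P t \<omega>) \<and> (\<forall>\<^sub>F n in sequentially. P (real n / 2) \<omega> < n)"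
proof -
  \<comment> \<open>The index is shifted by one because the Poisson parameter \<open>rate * t\<close> has to be positive.\<close>
  define f g :: "nat \<Rightarrow> 'a \<Rightarrow> real"
    where "f = (\<lambda>n \<omega>. 2 ^ P (real (Suc n) / 2) \<omega> / 2 ^ Suc n)"
      and "g = (\<lambda>n \<omega>. (1 / 2) ^ P (real (Suc n)) \<omega>)"
  note pgf = poisson_process_generating_function[OF P zero_less_one]
  have "exp (1 / 2) \<le> 1 + 1 / 2 + (1 / 2 :: real)\<^sup>2" by (rule exp_bound) auto
  then have e: "exp (1 / 2 :: real) < 2" by (simp add: power2_eq_square)
  have "(\<integral>\<omega>. f n \<omega> \<partial>M) = (exp (1 / 2) / 2) ^ Suc n" for n
    by (simp add: f_def pgf power_divide exp_of_nat_mult[symmetric] del: power_Suc)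
  moreover have "summable (\<lambda>n. (exp (1 / 2) / 2 :: real) ^ Suc n)"
    using e by (subst summable_Suc_iff) (simp add: summable_geometric)
  ultimately have "summable (\<lambda>n. \<integral>\<omega>. f n \<omega> \<partial>M)" by (simp only:)
  then have f: "AE \<omega> in M. (\<lambda>n. f n \<omega>) \<longlonglongrightarrow> 0"
    by (intro AE_tendsto_zero_of_summable_integrals) (auto simp: f_def pgf)
  have "(\<integral>\<omega>. g n \<omega> \<partial>M) = exp (- 1 / 2) ^ Suc n" for n
    by (simp add: g_def pgf exp_of_nat_mult[symmetric] del: power_Suc)
  moreover have "summable (\<lambda>n. exp (- 1 / 2 :: real) ^ Suc n)"
    by (subst summable_Suc_iff) (simp add: summable_geometric)
  ultimately have "summable (\<lambda>n. \<integral>\<omega>. g n \<omega> \<partial>M)" by (simp only:)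
  then have "AE \<omega> in M. (\<lambda>n. g n \<omega>) \<longlonglongrightarrow> 0"
    by (intro AE_tendsto_zero_of_summable_integrals) (auto simp: g_def pgf)
  with f show ?thesis
  proof eventually_elim
    case (elim \<omega>)
    have "\<exists>t\<ge>0. n \<le> P t \<omega>" for n
    proof -
      have "\<forall>\<^sub>F k in sequentially. g k \<omega> < (1 / 2) ^ n"
        using elim(2) by (rule order_tendstoD) simp
      then obtain k where "(1 / 2 :: real) ^ P (real (Suc k)) \<omega> < (1 / 2) ^ n"
        unfolding g_def by (auto dest: eventually_happens)
      then have "n < P (real (Suc k)) \<omega>" by (subst (asm) power_strict_decreasing_iff) auto
      then show ?thesis by (intro exI[of _ "real (Suc k)"]) auto
    qed
    moreover have "\<forall>\<^sub>F n in sequentially. f n \<omega> < 1"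
      using elim(1) by (rule order_tendstoD) simp
    then have "\<forall>\<^sub>F n in sequentially. P (real (Suc n) / 2) \<omega> < Suc n"
    proof eventually_elim
      case (elim n)
      then have "(2::real) ^ P (real (Suc n) / 2) \<omega> < 2 ^ Suc n"
        unfolding f_def by (subst (asm) pos_divide_less_eq) auto
      then show ?case by (subst (asm) power_strict_increasing_iff) auto
    qed
    then have "\<forall>\<^sub>F n in sequentially. P (real n / 2) \<omega> < n"
      by (rule eventually_sequentially_Suc[THEN iffD1])
    ultimately show ?case by blast
  qed
qed

lemma arrival_time_mono:
  assumes "\<exists>t\<ge>0. Suc n \<le> P t \<omega>"
  shows "arrival_time P n \<omega> \<le> arrival_time P (Suc n) \<omega>"
  unfolding arrival_time_def using assms
  by (intro cInf_superset_mono) (auto intro!: bdd_belowI[of _ 0])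

lemma arrival_time_ge:
  assumes "\<exists>t\<ge>0. n \<le> P t \<omega>" and "mono_on {0..} (\<lambda>t. P t \<omega>)" and "P s \<omega> < n"
  shows "s \<le> arrival_time P n \<omega>"
  unfolding arrival_time_def
proof (rule cInf_greatest)
  show "{t. 0 \<le> t \<and> n \<le> P t \<omega>} \<noteq> {}" using assms by auto
  fix t assume t: "t \<in> {t. 0 \<le> t \<and> n \<le> P t \<omega>}"
  show "s \<le> t"
  proof (rule ccontr)
    assume "\<not> s \<le> t"
    then have "P t \<omega> \<le> P s \<omega>" using t by (intro mono_onD[OF assms(2)]) auto
    then show False using t assms(3) by simp
  qed
qed

text \<open>
For large \<open>n\<close>, fewer than \<open>n\<close> points lie before time \<open>n / 2\<close>, so \<open>T n \<ge> n / 2\<close>. For the finitely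
many other \<open>n \<ge> 1\<close> a positive lower bound is enough: right continuity at \<open>0\<close> leaves an initial
interval without points.
\<close>

lemma AE_arrival_times_linear_growth:
  assumes P: "poisson_process M 1 P"
  shows "AE \<omega> in M. (\<forall>n. arrival_time P n \<omega> \<le> arrival_time P (Suc n) \<omega>) \<and>
    (\<exists>c>0. c \<le> 1 \<and> (\<forall>n\<ge>1. c * real n \<le> arrival_time P n \<omega>))"
  using AE_poisson_process_between[OF P] AE_space
proof eventually_elim
  case (elim \<omega>)
  let ?T = "\<lambda>n. arrival_time P n \<omega>"
  have ne: "\<exists>t\<ge>0. n \<le> P t \<omega>" for n using elim by blast
  have zero: "P 0 \<omega> = 0" and mono: "mono_on {0..} (\<lambda>t. P t \<omega>)"
    and cont: "continuous (at_right 0) (\<lambda>s. P s \<omega>)"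
    using P elim unfolding poisson_process_def by auto
  have "((\<lambda>s. P s \<omega>) \<longlongrightarrow> 0) (at_right 0)"
    using cont zero by (simp add: continuous_within)
  then have "\<forall>\<^sub>F s in at_right 0. P s \<omega> < 1" by (rule order_tendstoD) simp
  then obtain \<delta> :: real where \<delta>: "\<delta> > 0" "\<And>s. 0 < s \<Longrightarrow> s < \<delta> \<Longrightarrow> P s \<omega> < 1"
    unfolding eventually_at_right_field by auto
  obtain q where q: "\<And>n. n \<ge> q \<Longrightarrow> P (real n / 2) \<omega> < n"
    using elim unfolding eventually_sequentially by blast
  define c where "c = min (1 / 2) (\<delta> / 2 / (real q + 1))"
  have c: "c > 0" using \<delta> by (simp add: c_def)
  have "c * real n \<le> ?T n" if "n \<ge> 1" for n
  proof (cases "n \<ge> q")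
    case True
    have "c * real n \<le> 1 / 2 * real n" unfolding c_def by (intro mult_right_mono min.cobounded1) simp
    also have "\<dots> \<le> ?T n" using arrival_time_ge[of n P \<omega> "real n / 2", OF ne mono q[OF True]] by simp
    finally show ?thesis .
  next
    case False
    have "c * real n \<le> c * (real q + 1)" using False c by (intro mult_left_mono) auto
    also have "\<dots> \<le> \<delta> / 2 / (real q + 1) * (real q + 1)"
      unfolding c_def by (intro mult_right_mono) auto
    also have "\<dots> = \<delta> / 2" by (simp add: field_simps)
    also have "\<delta> / 2 \<le> ?T n"
    proof (rule arrival_time_ge[of n P \<omega> "\<delta> / 2", OF ne mono])
      have "P (\<delta> / 2) \<omega> < 1" using \<delta> by (intro \<delta>(2)) auto
      then show "P (\<delta> / 2) \<omega> < n" using that by simp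
    qed
    finally show ?thesis .
  qed
  moreover have "c \<le> 1" unfolding c_def by linarith
  ultimately show ?case using c arrival_time_mono[where P = P and \<omega> = \<omega>, OF ne] by blast
qed

section \<open>Summation by parts for one path\<close>

text \<open>
Summation by parts turns both sums into sums of \<open>f n - f (n + 1) \<ge> 0\<close> times \<open>W n\<close> or \<open>V n\<close>, which
can be compared term by term. The boundary terms at \<open>M\<close> cancel, and those at \<open>N\<close> add up to
\<open>2 * f (N + 1) * V N\<close>.
\<close>

lemma abel_comparison:
  fixes f W V :: "nat \<Rightarrow> real"
  assumes dec: "\<And>n. n > N \<Longrightarrow> f (Suc n) \<le> f n"
    and W: "\<And>n. \<bar>W n\<bar> \<le> V n" and nonneg: "\<And>n. 0 \<le> f n" and "N \<le> M"
  shows "\<bar>\<Sum>n\<in>{N..<M}. f (Suc n) * (W (Suc n) - W n)\<bar>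
     \<le> 2 * (f (Suc N) * V N) + (\<Sum>n\<in>{N..<M}. f (Suc n) * (V (Suc n) - V n))"
proof -
  \<comment> \<open>The sum without its boundary terms; unlike the sum itself, it can be compared by induction.\<close>
  let ?D = "\<lambda>U M. (\<Sum>n\<in>{N..<M}. f (Suc n) * (U (Suc n) - U n)) - f (Suc M) * U M + f (Suc N) * U N"
  have "\<bar>?D W M\<bar> \<le> ?D V M" using \<open>N \<le> M\<close>
  proof (induction M rule: dec_induct)
    case (step M)
    have inc: "?D U (Suc M) = ?D U M + (f (Suc M) - f (Suc (Suc M))) * U (Suc M)" for U :: "nat \<Rightarrow> real"
      using step.hyps by (simp add: algebra_simps)
    have d: "0 \<le> f (Suc M) - f (Suc (Suc M))" using dec[of "Suc M"] step.hyps by simp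
    have "\<bar>(f (Suc M) - f (Suc (Suc M))) * W (Suc M)\<bar> \<le> (f (Suc M) - f (Suc (Suc M))) * V (Suc M)"
      using d W[of "Suc M"] by (simp add: abs_mult mult_left_mono)
    then show ?case unfolding inc using step.IH by linarith
  qed simp
  moreover have "\<bar>f (Suc M) * W M\<bar> \<le> f (Suc M) * V M" "\<bar>f (Suc N) * W N\<bar> \<le> f (Suc N) * V N"
    using W nonneg by (auto simp: abs_mult intro!: mult_left_mono)
  ultimately show ?thesis by linarith
qed

text \<open>
The left side is a lower Riemann sum of \<open>x powr (- s)\<close> on \<open>{u..v}\<close>, the right side its integral.
\<close>

lemma powr_increment_le:
  fixes u v s :: real
  assumes "0 < u" "u \<le> v" "1 < s"
  shows "v powr (- s) * (v - u) \<le> (u powr (1 - s) - v powr (1 - s)) / (s - 1)"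
proof (cases "u = v")
  case False
  then have "u < v" using assms by simp
  moreover have "((\<lambda>x. x powr (1 - s)) has_real_derivative (1 - s) * x powr (- s)) (at x)"
    if "u \<le> x" for x
    using that assms by (auto intro!: derivative_eq_intros)
  ultimately obtain z where z: "u < z" "z < v"
      "v powr (1 - s) - u powr (1 - s) = (v - u) * ((1 - s) * z powr (- s))"
    using MVT2[of u v "\<lambda>x. x powr (1 - s)" "\<lambda>x. (1 - s) * x powr (- s)"] by auto
  have "v powr (- s) * (v - u) \<le> z powr (- s) * (v - u)"
    using z assms by (intro mult_right_mono powr_mono2') auto
  also have "\<dots> = (u powr (1 - s) - v powr (1 - s)) / (s - 1)"
    using z(3) assms by (simp add: field_simps)
  finally show ?thesis .
qed simp

lemma sum_powr_increments_le:
  fixes V :: "nat \<Rightarrow> real"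
  assumes pos: "0 < V N" and mono: "mono V" and "1 < s" "N \<le> M"
  shows "(\<Sum>n\<in>{N..<M}. V (Suc n) powr (- s) * (V (Suc n) - V n)) \<le> V N powr (1 - s) / (s - 1)"
proof -
  have pos: "0 < V n" if "N \<le> n" for n using pos monoD[OF mono that] by linarith
  have "(\<Sum>n\<in>{N..<M}. V (Suc n) powr (- s) * (V (Suc n) - V n))
      \<le> (\<Sum>n\<in>{N..<M}. (V n powr (1 - s) - V (Suc n) powr (1 - s)) / (s - 1))"
    using pos monoD[OF mono] assms by (intro sum_mono powr_increment_le) auto
  also have "\<dots> = (V N powr (1 - s) - V M powr (1 - s)) / (s - 1)"
    using sum_Suc_diff'[OF \<open>N \<le> M\<close>, of "\<lambda>n. - (V n powr (1 - s))"]
    by (simp add: sum_divide_distrib[symmetric])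
  also have "\<dots> \<le> V N powr (1 - s) / (s - 1)"
    using assms by (intro divide_right_mono) auto
  finally show ?thesis .
qed

lemma S_star_diff:
  assumes "N \<le> M"
  shows "S_star T X \<omega> M \<alpha> - S_star T X \<omega> N \<alpha>
    = (\<Sum>n\<in>{N..<M}. T (Suc n) \<omega> powr (- 1 / \<alpha>) * X (Suc n) \<omega>)"
  using assms
  by (induction M rule: dec_induct) (simp_all add: S_star_def)

text \<open>
Apply \<open>abel_comparison\<close> with \<open>V n = K * v n\<close>, where \<open>v n = n powr \<gamma>\<close>. In terms of \<open>v\<close> the weights
are at most \<open>D * v n powr (- s)\<close> with \<open>s = 1 / (b * \<gamma>) > 1\<close>, so \<open>sum_powr_increments_le\<close> bounds the
comparison sum by a multiple of \<open>v N powr (1 - s) = N powr (\<gamma> - 1 / b)\<close>. The constant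
\<open>D = c powr (- 1 / a)\<close> serves all \<open>\<alpha> \<ge> a\<close> because \<open>c \<le> 1\<close>.
\<close>

lemma S_star_increment_bound:
  fixes T X :: "nat \<Rightarrow> 'a \<Rightarrow> real"
  assumes W: "\<And>n. \<bar>\<Sum>i<n. X (Suc i) \<omega>\<bar> \<le> K * real n powr \<gamma>"
    and c: "0 < c" "c \<le> 1" "\<And>n. n \<ge> 1 \<Longrightarrow> c * real n \<le> T n \<omega>"
    and mono: "\<And>n. n \<ge> 1 \<Longrightarrow> T n \<omega> \<le> T (Suc n) \<omega>"
    and ab: "0 < a" "a \<le> b" and \<gamma>: "0 < \<gamma>" "\<gamma> < 1 / b"
  obtains C where "C \<ge> 0" "\<And>N M \<alpha>. 1 \<le> N \<Longrightarrow> N \<le> M \<Longrightarrow> \<alpha> \<in> {a..b} \<Longrightarrow>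
    \<bar>S_star T X \<omega> M \<alpha> - S_star T X \<omega> N \<alpha>\<bar> \<le> C * real N powr (\<gamma> - 1 / b)"
proof -
  define s D where "s = 1 / b / \<gamma>" and "D = c powr (- 1 / a)"
  have s: "1 < s" using \<gamma> ab by (simp add: s_def field_simps)
  have \<gamma>s: "\<gamma> * (- s) = - 1 / b" "\<gamma> * (1 - s) = \<gamma> - 1 / b"
    using \<gamma> by (simp_all add: s_def field_simps)
  have D: "D \<ge> 0" by (simp add: D_def)
  have K: "K \<ge> 0" using W[of 1] by simp
  define C where "C = K * D * (2 + 1 / (s - 1))"
  have "C \<ge> 0" using K D s by (simp add: C_def)
  moreover have "\<bar>S_star T X \<omega> M \<alpha> - S_star T X \<omega> N \<alpha>\<bar> \<le> C * real N powr (\<gamma> - 1 / b)"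
    if N: "1 \<le> N" "N \<le> M" and \<alpha>: "\<alpha> \<in> {a..b}" for N M \<alpha>
  proof -
    define f where "f = (\<lambda>n. T n \<omega> powr (- 1 / \<alpha>))"
    define v where "v = (\<lambda>n. real n powr \<gamma>)"
    define W where "W = (\<lambda>n. \<Sum>i<n. X (Suc i) \<omega>)"
    have \<alpha>': "0 < \<alpha>" "\<alpha> \<le> b" "a \<le> \<alpha>" using \<alpha> ab by auto
    have v_mono: "mono v" using \<gamma> by (auto simp: v_def mono_def intro!: powr_mono2)
    have pos: "0 < T n \<omega>" if "n \<ge> 1" for n
    proof -
      have "0 < c * real n" using c that by simp
      then show ?thesis using c(3)[OF that] by linarith
    qed
    have dec: "f (Suc n) \<le> f n" if "n > N" for n
      unfolding f_def using that N \<alpha>' by (intro powr_mono2' pos mono) auto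
    have f_le: "f n \<le> D * v n powr (- s)" if n: "n \<ge> 1" for n
    proof -
      have "f n \<le> (c * real n) powr (- 1 / \<alpha>)"
        unfolding f_def using n c \<alpha>' by (intro powr_mono2') auto
      also have "\<dots> = c powr (- 1 / \<alpha>) * real n powr (- 1 / \<alpha>)"
        using c by (simp add: powr_mult)
      also have "\<dots> \<le> D * real n powr (- 1 / b)"
        unfolding D_def
      proof (intro mult_mono)
        show "c powr (- 1 / \<alpha>) \<le> c powr (- 1 / a)"
          using c \<alpha>' ab by (intro powr_mono') (auto simp: field_simps)
        show "real n powr (- 1 / \<alpha>) \<le> real n powr (- 1 / b)"
          using n \<alpha>' ab by (intro powr_mono) (auto simp: field_simps)
      qed auto
      also have "real n powr (- 1 / b) = v n powr (- s)"
        by (simp only: v_def powr_powr \<gamma>s)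
      finally show ?thesis .
    qed
    have vN: "0 < v N" using N by (simp add: v_def)
    have "S_star T X \<omega> M \<alpha> - S_star T X \<omega> N \<alpha> = (\<Sum>n\<in>{N..<M}. f (Suc n) * (W (Suc n) - W n))"
      by (simp add: S_star_diff N f_def W_def)
    also have "\<bar>\<dots>\<bar> \<le> 2 * (f (Suc N) * (K * v N)) + (\<Sum>n\<in>{N..<M}. f (Suc n) * (K * v (Suc n) - K * v n))"
      using N assms(1) by (intro abel_comparison dec) (auto simp: f_def v_def W_def)
    also have "\<dots> \<le> 2 * (D * v N powr (- s) * (K * v N))
        + (\<Sum>n\<in>{N..<M}. K * D * (v (Suc n) powr (- s) * (v (Suc n) - v n)))"
    proof (intro add_mono mult_left_mono mult_right_mono sum_mono)
      have "f (Suc N) \<le> D * v (Suc N) powr (- s)" by (intro f_le) simp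
      also have "\<dots> \<le> D * v N powr (- s)"
        using vN s monoD[OF v_mono, of N "Suc N"] D by (intro mult_left_mono powr_mono2') auto
      finally show "f (Suc N) \<le> D * v N powr (- s)" .
    next
      fix n
      have "f (Suc n) * (K * (v (Suc n) - v n)) \<le> D * v (Suc n) powr (- s) * (K * (v (Suc n) - v n))"
        using K monoD[OF v_mono, of n "Suc n"] by (intro mult_right_mono f_le) auto
      then show "f (Suc n) * (K * v (Suc n) - K * v n) \<le> K * D * (v (Suc n) powr (- s) * (v (Suc n) - v n))"
        by (simp add: algebra_simps)
    qed (use K vN in auto)
    also have "v N powr (- s) * v N = v N powr (1 - s)"
      using vN by (simp add: powr_diff powr_minus field_simps)
    then have "2 * (D * v N powr (- s) * (K * v N)) = 2 * (K * D * v N powr (1 - s))"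
      by (simp add: algebra_simps)
    also have "(\<Sum>n\<in>{N..<M}. K * D * (v (Suc n) powr (- s) * (v (Suc n) - v n)))
        \<le> K * D * (v N powr (1 - s) / (s - 1))"
      unfolding sum_distrib_left[symmetric]
      using K D vN v_mono s N by (intro mult_left_mono sum_powr_increments_le) auto
    also have "2 * (K * D * v N powr (1 - s)) + K * D * (v N powr (1 - s) / (s - 1)) = C * v N powr (1 - s)"
      by (simp add: C_def algebra_simps)
    also have "v N powr (1 - s) = real N powr (\<gamma> - 1 / b)"
      by (simp only: v_def powr_powr \<gamma>s)
    finally show ?thesis by simp
  qed
  ultimately show ?thesis by (rule that)
qed

lemma uniformly_convergent_of_increment_bound:
  fixes F :: "nat \<Rightarrow> 'b \<Rightarrow> real"
  assumes bound: "\<And>N M \<alpha>. 1 \<le> N \<Longrightarrow> N \<le> M \<Longrightarrow> \<alpha> \<in> A \<Longrightarrow> \<bar>F M \<alpha> - F N \<alpha>\<bar> \<le> e N"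
    and e: "e \<longlonglongrightarrow> 0"
  shows "uniformly_convergent_on A F"
proof (rule Cauchy_uniformly_convergent, rule uniformly_Cauchy_onI')
  fix \<epsilon> :: real assume "\<epsilon> > 0"
  then obtain N0 where N0: "\<And>N. N \<ge> N0 \<Longrightarrow> e N < \<epsilon>"
    using order_tendstoD(2)[OF e] unfolding eventually_sequentially by blast
  have "dist (F m \<alpha>) (F n \<alpha>) < \<epsilon>" if "\<alpha> \<in> A" "m \<ge> max 1 N0" "n > m" for \<alpha> m n
    using bound[of m n \<alpha>] N0[of m] that by (simp add: dist_real_def abs_minus_commute)
  then show "\<exists>M. \<forall>\<alpha>\<in>A. \<forall>m\<ge>M. \<forall>n>m. dist (F m \<alpha>) (F n \<alpha>) < \<epsilon>" by blast
qed

lemma S_star_tail_bound: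
  assumes conv: "convergent (\<lambda>N. S_star T X \<omega> N \<alpha>)"
    and bound: "\<And>M. N \<le> M \<Longrightarrow> \<bar>S_star T X \<omega> M \<alpha> - S_star T X \<omega> N \<alpha>\<bar> \<le> B"
  shows "\<bar>S_star_tail T X \<omega> N \<alpha>\<bar> \<le> B"
proof -
  define f where "f = (\<lambda>k. T (N + 1 + k) \<omega> powr (- 1 / \<alpha>) * X (N + 1 + k) \<omega>)"
  have part: "(\<Sum>k<j. f k) = S_star T X \<omega> (N + j) \<alpha> - S_star T X \<omega> N \<alpha>" for j
    by (induction j) (simp_all add: f_def S_star_def)
  obtain L where "(\<lambda>N. S_star T X \<omega> N \<alpha>) \<longlonglongrightarrow> L" using conv by (auto simp: convergent_def)
  then have "(\<lambda>j. S_star T X \<omega> (N + j) \<alpha>) \<longlonglongrightarrow> L"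
    using LIMSEQ_ignore_initial_segment[of _ L N] by (simp add: add.commute)
  then have lim: "(\<lambda>j. \<Sum>k<j. f k) \<longlonglongrightarrow> L - S_star T X \<omega> N \<alpha>"
    unfolding part by (intro tendsto_intros)
  then have "S_star_tail T X \<omega> N \<alpha> = L - S_star T X \<omega> N \<alpha>"
    unfolding S_star_tail_def f_def[symmetric] by (simp add: sums_def sums_unique[symmetric])
  moreover have "\<bar>L - S_star T X \<omega> N \<alpha>\<bar> \<le> B"
    by (rule LIMSEQ_le_const2[OF tendsto_rabs[OF lim]]) (auto simp: part intro!: bound)
  ultimately show ?thesis by simp
qed

section \<open>Uniform convergence and rate of the series\<close>

theorem theorem4p1:
  fixes M :: "'a measure"
    and P :: "real \<Rightarrow> 'a \<Rightarrow> nat"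
    and T X :: "nat \<Rightarrow> 'a \<Rightarrow> real"
    and p :: real
  assumes "prob_space M"
    and "poisson_process M 1 P"
    and "T = arrival_time P"
    and "prob_space.indep_vars M (\<lambda>_. borel) X {1..}"
    and "\<And>n. n \<ge> 1 \<Longrightarrow> distr M borel (X n) = distr M borel (X 1)"
    and "\<And>n. n \<ge> 1 \<Longrightarrow> symmetric_rv M (X n)"
    and "prob_space.indep_var M
           (PiM {1..} (\<lambda>_. borel)) (\<lambda>\<omega>. \<lambda>n\<in>{1..}. T n \<omega>)
           (PiM {1..} (\<lambda>_. borel)) (\<lambda>\<omega>. \<lambda>n\<in>{1..}. X n \<omega>)"
    and "p > 0"
    and "integrable M (\<lambda>\<omega>. \<bar>X 1 \<omega>\<bar> powr (2 * p))"
  shows "(AE \<omega> in M. \<forall>b\<in>{0<..<min 2 (2 * p)}. \<forall>a\<in>{0<..b}.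
            uniformly_convergent_on {a..b} (S_star T X \<omega>)) \<and>
         (AE \<omega> in M. \<forall>b\<in>{0<..<min 2 (2 * p)}. \<forall>a\<in>{0<..<b}. \<forall>p'>0.
            1 / p' \<in> {0<..<1 / b - 1 / min (2 * p) 2} \<longrightarrow>
            (SUP N::nat. SUP \<alpha>\<in>{a..b}.
               ennreal (real N powr (1 / p') * \<bar>S_star_tail T X \<omega> N \<alpha>\<bar>)) < \<infinity>)"
proof -
  interpret prob_space M by fact
  define q where "q = min (2 * p) 2"
  have q: "0 < q" "q \<le> 2" "q \<le> 2 * p" using \<open>p > 0\<close> by (auto simp: q_def)
  have [measurable]: "X (Suc 0) \<in> borel_measurable M"
    using assms(6)[of 1] by (simp add: symmetric_rv_def)
  have moment: "integrable M (\<lambda>\<omega>. \<bar>X 1 \<omega>\<bar> powr q)"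
  proof (rule Bochner_Integration.integrable_bound)
    show "integrable M (\<lambda>\<omega>. 1 + \<bar>X 1 \<omega>\<bar> powr (2 * p))" using assms(9) by simp
    have "\<bar>x\<bar> powr q \<le> 1 + \<bar>x\<bar> powr (2 * p)" for x :: real
    proof (cases "\<bar>x\<bar> \<le> 1")
      case True
      then have "\<bar>x\<bar> powr q \<le> 1" using q powr_mono2[of q "\<bar>x\<bar>" 1] by simp
      then show ?thesis by (simp add: add_increasing2)
    next
      case False
      then have "\<bar>x\<bar> powr q \<le> \<bar>x\<bar> powr (2 * p)" using q by (intro powr_mono) auto
      then show ?thesis by simp
    qed
    then show "AE \<omega> in M. norm (\<bar>X 1 \<omega>\<bar> powr q) \<le> norm (1 + \<bar>X 1 \<omega>\<bar> powr (2 * p))"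
      by (simp add: add_nonneg_nonneg)
  qed simp
  have indep: "indep_var borel (X (Suc i)) borel (X (Suc j))" if "i \<noteq> j" for i j
    using indep_vars_sum[of "{Suc j}" "Suc i" X] that indep_vars_subset[OF assms(4), of "{Suc i, Suc j}"]
    by simp
  have ident: "distr M borel (X (Suc n)) = distr M borel (X (Suc 0))" for n
    using assms(5)[of "Suc n"] by simp
  \<comment> \<open>A countable family of exponents decreasing to \<open>1 / q\<close>.\<close>
  define \<gamma> where "\<gamma> = (\<lambda>j::nat. 1 / q + inverse (real (Suc j)))"
  have "AE \<omega> in M. \<exists>K. \<forall>n. \<bar>\<Sum>i<n. X (Suc i) \<omega>\<bar> \<le> K * real n powr \<gamma> j" for j
    using moment q assms(6)
    by (intro AE_identically_distributed_symmetric_sums_bounded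
          [where X = "\<lambda>i. X (Suc i)", OF \<open>prob_space M\<close> indep ident])
       (auto simp: \<gamma>_def)
  then have sums: "AE \<omega> in M. \<forall>j. \<exists>K. \<forall>n. \<bar>\<Sum>i<n. X (Suc i) \<omega>\<bar> \<le> K * real n powr \<gamma> j"
    by (simp add: AE_all_countable)
  \<comment> \<open>The deterministic property of a path from which both assertions follow for all parameters.\<close>
  define good where "good \<omega> \<longleftrightarrow> (\<forall>b \<eta>. 0 < b \<longrightarrow> 0 \<le> \<eta> \<longrightarrow> \<eta> < 1 / b - 1 / q \<longrightarrow>
      (\<forall>a\<in>{0<..b}. \<exists>C\<ge>0. \<forall>N\<ge>1. \<forall>M\<ge>N. \<forall>\<alpha>\<in>{a..b}.
        \<bar>S_star T X \<omega> M \<alpha> - S_star T X \<omega> N \<alpha>\<bar> \<le> C * real N powr (- \<eta>)))" for \<omega>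
  have "AE \<omega> in M. good \<omega>"
    using sums AE_arrival_times_linear_growth[OF assms(2)]
  proof eventually_elim
    case (elim \<omega>)
    show ?case unfolding good_def
    proof (intro allI impI ballI)
      fix a b \<eta> :: real
      assume b: "0 < b" and \<eta>: "0 \<le> \<eta>" "\<eta> < 1 / b - 1 / q" and a: "a \<in> {0<..b}"
      obtain j where j: "inverse (real (Suc j)) < 1 / b - 1 / q - \<eta>"
        using reals_Archimedean[of "1 / b - 1 / q - \<eta>"] \<eta> by auto
      have \<gamma>: "0 < \<gamma> j" "\<gamma> j < 1 / b" "\<gamma> j - 1 / b \<le> - \<eta>"
        using j q \<eta> by (auto simp: \<gamma>_def add_pos_pos simp del: of_nat_Suc)
      obtain K where K: "\<And>n. \<bar>\<Sum>i<n. X (Suc i) \<omega>\<bar> \<le> K * real n powr \<gamma> j" using elim by blast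
      obtain c where c: "c > 0" "c \<le> 1" "\<And>n. n \<ge> 1 \<Longrightarrow> c * real n \<le> T n \<omega>"
        using elim unfolding assms(3) by blast
      have mono: "T n \<omega> \<le> T (Suc n) \<omega>" for n using elim unfolding assms(3) by blast
      obtain C where C: "C \<ge> 0" "\<And>N M \<alpha>. 1 \<le> N \<Longrightarrow> N \<le> M \<Longrightarrow> \<alpha> \<in> {a..b} \<Longrightarrow>
          \<bar>S_star T X \<omega> M \<alpha> - S_star T X \<omega> N \<alpha>\<bar> \<le> C * real N powr (\<gamma> j - 1 / b)"
        using S_star_increment_bound[of X \<omega> K "\<gamma> j" c T a b, OF K c mono] a \<gamma> by auto
      have "\<bar>S_star T X \<omega> M \<alpha> - S_star T X \<omega> N \<alpha>\<bar> \<le> C * real N powr (- \<eta>)"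
        if "1 \<le> N" "N \<le> M" "\<alpha> \<in> {a..b}" for N M \<alpha>
      proof -
        have "C * real N powr (\<gamma> j - 1 / b) \<le> C * real N powr (- \<eta>)"
          using that C(1) \<gamma> by (intro mult_left_mono powr_mono) auto
        then show ?thesis using C(2)[OF that] by linarith
      qed
      then show "\<exists>C\<ge>0. \<forall>N\<ge>1. \<forall>M\<ge>N. \<forall>\<alpha>\<in>{a..b}.
          \<bar>S_star T X \<omega> M \<alpha> - S_star T X \<omega> N \<alpha>\<bar> \<le> C * real N powr (- \<eta>)"
        using C(1) by blast
    qed
  qed
  moreover have conv: "uniformly_convergent_on {a..b} (S_star T X \<omega>)"
    if good: "good \<omega>" and b: "b \<in> {0<..<min 2 (2 * p)}" and a: "a \<in> {0<..b}" for \<omega> a b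
  proof -
    \<comment> \<open>For convergence any positive rate \<open>\<eta>\<close> will do; half of the available range is taken.\<close>
    define \<eta> where "\<eta> = (1 / b - 1 / q) / 2"
    have "1 / q < 1 / b" using b q by (intro divide_strict_left_mono) (auto simp: q_def)
    then have \<eta>: "0 < \<eta>" "\<eta> < 1 / b - 1 / q" by (auto simp: \<eta>_def)
    then obtain C where C: "\<And>N M \<alpha>. 1 \<le> N \<Longrightarrow> N \<le> M \<Longrightarrow> \<alpha> \<in> {a..b} \<Longrightarrow>
        \<bar>S_star T X \<omega> M \<alpha> - S_star T X \<omega> N \<alpha>\<bar> \<le> C * real N powr (- \<eta>)"
      using good a b unfolding good_def by (meson greaterThanLessThan_iff less_imp_le)
    have "(\<lambda>N. real N powr (- \<eta>)) \<longlonglongrightarrow> 0"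
      using \<eta>(1) by (intro tendsto_neg_powr filterlim_real_sequentially) auto
    then have "(\<lambda>N. C * real N powr (- \<eta>)) \<longlonglongrightarrow> 0" by (rule tendsto_mult_right_zero)
    with C show ?thesis by (rule uniformly_convergent_of_increment_bound)
  qed
  moreover have "(SUP N::nat. SUP \<alpha>\<in>{a..b}.
      ennreal (real N powr (1 / p') * \<bar>S_star_tail T X \<omega> N \<alpha>\<bar>)) < \<infinity>"
    if good: "good \<omega>" and b: "b \<in> {0<..<min 2 (2 * p)}" and a: "a \<in> {0<..<b}"
      and p': "1 / p' \<in> {0<..<1 / b - 1 / min (2 * p) 2}" for \<omega> a b p'
  proof -
    have "0 < b" "0 \<le> 1 / p'" "1 / p' < 1 / b - 1 / q" "a \<in> {0<..b}"
      using b p' a by (auto simp: q_def)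
    then obtain C where C: "C \<ge> 0" "\<And>N M \<alpha>. 1 \<le> N \<Longrightarrow> N \<le> M \<Longrightarrow> \<alpha> \<in> {a..b} \<Longrightarrow>
        \<bar>S_star T X \<omega> M \<alpha> - S_star T X \<omega> N \<alpha>\<bar> \<le> C * real N powr (- (1 / p'))"
      using good unfolding good_def by meson
    have "real N powr (1 / p') * \<bar>S_star_tail T X \<omega> N \<alpha>\<bar> \<le> C" if \<alpha>: "\<alpha> \<in> {a..b}" for N \<alpha>
    proof (cases "N = 0")
      case False
      have "convergent (\<lambda>N. S_star T X \<omega> N \<alpha>)"
        using conv[OF good b] a \<alpha> by (intro uniformly_convergent_imp_convergent[of "{a..b}"]) auto
      then have "\<bar>S_star_tail T X \<omega> N \<alpha>\<bar> \<le> C * real N powr (- (1 / p'))"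
        using False \<alpha> by (intro S_star_tail_bound C(2)) auto
      then have "real N powr (1 / p') * \<bar>S_star_tail T X \<omega> N \<alpha>\<bar>
          \<le> real N powr (1 / p') * (C * real N powr (- (1 / p')))"
        by (rule mult_left_mono) simp
      also have "\<dots> = C" using False by (simp add: powr_minus field_simps)
      finally show ?thesis .
    qed (use C in simp)
    then have "(SUP N::nat. SUP \<alpha>\<in>{a..b}.
        ennreal (real N powr (1 / p') * \<bar>S_star_tail T X \<omega> N \<alpha>\<bar>)) \<le> ennreal C"
      by (intro SUP_least ennreal_leI)
    then show ?thesis by (rule le_less_trans) simp
  qed
  ultimately show ?thesis
    by (auto elim!: eventually_mono)
qed

end
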